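(* Let $\mu_1,\mu_2,\mu_3,\mu_4>0$ and let $(\theta_1,\theta_2,\theta_3,\theta_4)$ be a central configuration of the planar $1+4$ body problem associated to the mass parameters $\mu_1,\mu_2,\mu_3,\mu_4$. Suppose that the massive body and the satellites with mass parameters $\mu_1$ and $\mu_3$ are collinear, i.e. $\theta_1+\theta_2=\pi=\theta_3+\theta_4$. Then $\theta_1=\theta_4$ and $\theta_2=\theta_3$ (i.e. the configuration is symmetric). Furthermore, the other two satellites have the same mass parameter: $\mu_2=\mu_4$.
   Context: In the planar $1+4$ body problem, a massive body sits at the center of a circle and four satellites, with infinitesimal-mass parameters $\mu_1,\mu_2,\mu_3,\mu_4\in\mathbb{R}^+$ (positive reals), lie on the circle in cyclic order at distinct points. The coordinates are the angles between consecutive satellites: $\theta_i$ is the angle from satellite $i$ to satellite $i+1$ for $i=1,2,3$, and $\theta_4$ is the angle from satellite $4$ to satellite $1$. Thus $\theta_i>0$ for all $i$ and $\theta_1+\theta_2+\theta_3+\theta_4=2\pi$. Define $f:(0,2\pi)\to\mathbb{R}$ by $f(x)=\sin(x)\left(1-\frac{1}{8|\sin^3(x/2)|}\right)$. Definition: given $\mu_1,\dots,\mu_4>0$, a central configuration of the planar $1+4$ body problem associated to the mass parameters $\mu_1,\mu_2,\mu_3,\mu_4$ is a tuple $(\theta_1,\theta_2,\theta_3,\theta_4)$ with all $\theta_i>0$ and $\theta_1+\theta_2+\theta_3+\theta_4=2\pi$ that satisfies $$\mu_2f(\theta_1)+\mu_3f(\theta_1+\theta_2)+\mu_4f(\theta_1+\theta_2+\theta_3)=0,$$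 $$\mu_3f(\theta_2)+\mu_4f(\theta_2+\theta_3)+\mu_1f(\theta_2+\theta_3+\theta_4)=0,$$ $$\mu_4f(\theta_3)+\mu_1f(\theta_3+\theta_4)+\mu_2f(\theta_3+\theta_4+\theta_1)=0,$$ $$\mu_1f(\theta_4)+\mu_2f(\theta_4+\theta_1)+\mu_3f(\theta_4+\theta_1+\theta_2)=0.$$ *)

theory Defs
  imports Complex_Main
begin

(* The intended domain is 0 < x < 2 * pi, where sin (x / 2) is nonzero.
   In a central configuration every argument of f lies in this interval. *)
definition f :: "real \<Rightarrow> real" where
  "f x = sin x * (1 - 1 / (8 * \<bar>sin (x / 2) ^ 3\<bar>))"

definition central_configuration ::
  "real \<Rightarrow> real \<Rightarrow> real \<Rightarrow> real \<Rightarrow> real \<Rightarrow> real \<Rightarrow> real \<Rightarrow> real \<Rightarrow> bool" where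
  "central_configuration \<mu>1 \<mu>2 \<mu>3 \<mu>4 \<theta>1 \<theta>2 \<theta>3 \<theta>4 \<longleftrightarrow>
     \<theta>1 > 0 \<and> \<theta>2 > 0 \<and> \<theta>3 > 0 \<and> \<theta>4 > 0 \<and>
     \<theta>1 + \<theta>2 + \<theta>3 + \<theta>4 = 2 * pi \<and>
     \<mu>2 * f \<theta>1 + \<mu>3 * f (\<theta>1 + \<theta>2) + \<mu>4 * f (\<theta>1 + \<theta>2 + \<theta>3) = 0 \<and>
     \<mu>3 * f \<theta>2 + \<mu>4 * f (\<theta>2 + \<theta>3) + \<mu>1 * f (\<theta>2 + \<theta>3 + \<theta>4) = 0 \<and>
     \<mu>4 * f \<theta>3 + \<mu>1 * f (\<theta>3 + \<theta>4) + \<mu>2 * f (\<theta>3 + \<theta>4 + \<theta>1) = 0 \<and>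
     \<mu>1 * f \<theta>4 + \<mu>2 * f (\<theta>4 + \<theta>1) + \<mu>3 * f (\<theta>4 + \<theta>1 + \<theta>2) = 0"

end

theory Submission
  imports Defs
begin

text \<open>
  With \<open>\<theta>1 + \<theta>2 = \<theta>3 + \<theta>4 = pi\<close>, the first and third equations reduce to
  \<open>\<mu>2 * f \<theta>1 = \<mu>4 * f \<theta>4\<close> and \<open>\<mu>2 * f \<theta>2 = \<mu>4 * f \<theta>3\<close>.
  Put \<open>h s = 1 - 1 / (8 * s ^ 3)\<close>, \<open>t = \<theta>1 / 2\<close> and \<open>u = \<theta>4 / 2\<close>. Up to positive factors, these say
  that \<open>(h (sin t), h (cos t))\<close> and \<open>(h (sin u), h (cos u))\<close> are positively proportional.
  The Wronskian of \<open>h (sin t)\<close> and \<open>h (cos t)\<close> has the sign of \<open>8 * (sin t ^ 5 + cos t ^ 5) - 1 > 0\<close>,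
  so \<open>h (sin t) / h (cos t)\<close> is strictly increasing on each interval where \<open>h (cos t)\<close> does not
  vanish, which forces \<open>t = u\<close>. The masses agree because \<open>h (sin t)\<close> and \<open>h (cos t)\<close> never vanish
  simultaneously.
\<close>

definition h :: "real \<Rightarrow> real" where
  "h s = 1 - 1 / (8 * s ^ 3)"

lemma h_mono:
  assumes "0 < x" "x \<le> y"
  shows "h x \<le> h y"
proof -
  have "x ^ 3 \<le> y ^ 3" "0 < x ^ 3"
    using assms by (auto intro: power_mono)
  then show ?thesis
    unfolding h_def by (simp add: frac_le)
qed

lemma h_eq_0_iff:
  assumes "0 < x"
  shows "h x = 0 \<longleftrightarrow> x = 1 / 2"
proof -
  have "h x = 0 \<longleftrightarrow> x ^ 3 = (1 / 2) ^ 3"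
    using assms by (auto simp: h_def field_simps)
  also have "\<dots> \<longleftrightarrow> x = 1 / 2"
    using assms by (intro power_eq_iff_eq_base) auto
  finally show ?thesis .
qed

lemma f_eq_h:
  assumes "0 < x" "x < 2 * pi"
  shows "f x = sin x * h (sin (x / 2))"
proof -
  have "sin (x / 2) > 0"
    using assms by (intro sin_gt_zero) auto
  then show ?thesis
    by (simp add: f_def h_def)
qed

lemma f_pi_minus:
  assumes "0 < x" "x < pi"
  shows "f (pi - x) = sin x * h (cos (x / 2))"
proof -
  have "sin ((pi - x) / 2) = cos (x / 2)"
    by (simp add: diff_divide_distrib sin_diff)
  then show ?thesis
    using assms f_eq_h[of "pi - x"] by simp
qed

lemma f_two_pi_minus: "f (2 * pi - x) = - f x"
proof -
  have "sin ((2 * pi - x) / 2) = sin (x / 2)"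
    by (simp add: diff_divide_distrib)
  then show ?thesis
    by (simp add: f_def sin_diff)
qed

text \<open>The larger of \<open>s\<close> and \<open>c\<close> has square at least 1/2, and 8 times
  its fifth power is then at least \<open>sqrt 2\<close>, so one term already suffices.\<close>

lemma sum_fifth_powers_gt:
  fixes s c :: real
  assumes "0 < s" "0 < c" "s\<^sup>2 + c\<^sup>2 = 1"
  shows "1 < 8 * (s ^ 5 + c ^ 5)"
proof -
  have large: "1 < 8 * x ^ 5" if "0 < x" "1 / 2 \<le> x\<^sup>2" for x :: real
  proof -
    \<comment> \<open>7/10 is a rational stand-in for \<open>sqrt (1 / 2)\<close>: its square is
      below 1/2, yet 8 times its fifth power is about 1.34.\<close>
    have "(7 / 10)\<^sup>2 \<le> x\<^sup>2"
      using that(2) by (simp add: power2_eq_square)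
    then have "7 / 10 \<le> x"
      using that(1) by (rule power2_le_imp_le[OF _ less_imp_le])
    then have "(7 / 10) ^ 5 \<le> x ^ 5"
      by (intro power_mono) auto
    then show ?thesis
      by (simp add: eval_nat_numeral)
  qed
  have "0 < s ^ 5" "0 < c ^ 5"
    using assms by auto
  moreover have "1 / 2 \<le> s\<^sup>2 \<or> 1 / 2 \<le> c\<^sup>2"
    using assms(3) by linarith
  ultimately show ?thesis
    using large[OF assms(1)] large[OF assms(2)] unfolding distrib_left by linarith
qed

text \<open>As the derivative of \<open>h\<close> at \<open>y\<close> is
  \<open>3 / (8 * y ^ 4)\<close>, this is the numerator in the quotient rule for
  \<open>h (sin x) / h (cos x)\<close>, with \<open>s = sin x\<close> and
  \<open>c = cos x\<close>.\<close>

lemma h_Wronskian_pos: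
  fixes s c :: real
  assumes "0 < s" "0 < c" "s\<^sup>2 + c\<^sup>2 = 1"
  shows "0 < 3 * c / (8 * s ^ 4) * h c + h s * (3 * s / (8 * c ^ 4))"
proof -
  have h_c: "h c = (8 * c ^ 3 - 1) / (8 * c ^ 3)" and h_s: "h s = (8 * s ^ 3 - 1) / (8 * s ^ 3)"
    using assms(1,2) by (auto simp: h_def diff_divide_distrib)
  \<comment> \<open>Both terms are brought to one symmetric denominator, so that the negative parts
    add up to \<open>s\<^sup>2 + c\<^sup>2 = 1\<close>.\<close>
  have "3 * c / (8 * s ^ 4) * h c = 3 * (8 * c ^ 5 - c\<^sup>2) / (64 * s ^ 4 * c ^ 4)"
    unfolding h_c times_divide_times_eq using assms(1,2)
    by (subst frac_eq_eq) (simp, simp, algebra)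
  moreover have "h s * (3 * s / (8 * c ^ 4)) = 3 * (8 * s ^ 5 - s\<^sup>2) / (64 * s ^ 4 * c ^ 4)"
    unfolding h_s times_divide_times_eq using assms(1,2)
    by (subst frac_eq_eq) (simp, simp, algebra)
  moreover have "3 * (8 * (s ^ 5 + c ^ 5) - (s\<^sup>2 + c\<^sup>2))
      = 3 * (8 * c ^ 5 - c\<^sup>2) + 3 * (8 * s ^ 5 - s\<^sup>2)"
    by algebra
  ultimately have "3 * c / (8 * s ^ 4) * h c + h s * (3 * s / (8 * c ^ 4))
      = 3 * (8 * (s ^ 5 + c ^ 5) - (s\<^sup>2 + c\<^sup>2)) / (64 * s ^ 4 * c ^ 4)"
    by (simp only: add_divide_distrib)
  then show ?thesis
    using assms sum_fifth_powers_gt[OF assms] by simp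
qed

lemma h_ratio_strict_mono:
  assumes "0 < t" "t < u" "u < pi / 2" "0 < h (cos t) * h (cos u)"
  shows "h (sin t) / h (cos t) < h (sin u) / h (cos u)"
proof (rule DERIV_pos_imp_increasing[OF \<open>t < u\<close>])
  fix x assume x: "t \<le> x" "x \<le> u"
  have s: "0 < sin x" and c: "0 < cos x"
    using assms x by (auto intro: sin_gt_zero cos_gt_zero)
  \<comment> \<open>\<open>h (cos x)\<close> lies between two nonzero values of the same sign, so
    the quotient has no pole on the interval.\<close>
  have "0 < cos u" "cos u \<le> cos x" "cos x \<le> cos t"
    using assms x by (auto intro: cos_gt_zero cos_monotone_0_pi_le)
  then have "h (cos u) \<le> h (cos x)" "h (cos x) \<le> h (cos t)"
    by (auto intro: h_mono)
  then have nz: "h (cos x) \<noteq> 0"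
    using assms(4) by (auto simp: zero_less_mult_iff)
  have h_deriv: "(h has_real_derivative 3 / (8 * y ^ 4)) (at y)" if "0 < y" for y
    unfolding h_def using that
    by (auto intro!: derivative_eq_intros simp: field_simps eval_nat_numeral)
  have "((\<lambda>x. h (sin x)) has_real_derivative 3 / (8 * sin x ^ 4) * cos x) (at x)"
    by (rule DERIV_chain2[OF h_deriv[OF s] DERIV_sin])
  moreover have "((\<lambda>x. h (cos x)) has_real_derivative 3 / (8 * cos x ^ 4) * - sin x) (at x)"
    by (rule DERIV_chain2[OF h_deriv[OF c] DERIV_cos])
  ultimately have "((\<lambda>x. h (sin x) / h (cos x)) has_real_derivative
      (3 / (8 * sin x ^ 4) * cos x * h (cos x) - h (sin x) * (3 / (8 * cos x ^ 4) * - sin x))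
        / (h (cos x) * h (cos x))) (at x)"
    using nz by (rule DERIV_divide)
  moreover have "0 < (3 / (8 * sin x ^ 4) * cos x * h (cos x)
      - h (sin x) * (3 / (8 * cos x ^ 4) * - sin x)) / (h (cos x) * h (cos x))"
  proof (rule divide_pos_pos)
    show "0 < 3 / (8 * sin x ^ 4) * cos x * h (cos x)
        - h (sin x) * (3 / (8 * cos x ^ 4) * - sin x)"
      using h_Wronskian_pos[OF s c] by simp
    show "0 < h (cos x) * h (cos x)"
      using nz by (auto simp: zero_less_mult_iff linorder_neq_iff)
  qed
  ultimately show "\<exists>y. ((\<lambda>x. h (sin x) / h (cos x)) has_real_derivative y) (at x) \<and> 0 < y"
    by blast
qed

lemma proportional_imp_eq:
  assumes t: "0 < t" "t < pi / 2" and u: "0 < u" "u < pi / 2" and pos: "0 < a" "0 < b"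
    and sin_eq: "a * h (sin t) = b * h (sin u)" and cos_eq: "a * h (cos t) = b * h (cos u)"
  shows "t = u"
proof (cases "h (cos t) = 0")
  case True
  then have "h (cos u) = 0"
    using cos_eq pos by simp
  moreover have "0 < cos t" "0 < cos u"
    using t u by (auto intro: cos_gt_zero)
  ultimately have "cos t = cos u"
    using True by (simp add: h_eq_0_iff)
  then show ?thesis
    using t u cos_inj_pi[of t u] by simp
next
  case False
  have h_cos_u: "h (cos u) = a / b * h (cos t)" and h_sin_u: "h (sin u) = a / b * h (sin t)"
    using sin_eq cos_eq pos by (auto simp: field_simps)
  \<comment> \<open>Since \<open>a / b\<close> is positive, \<open>h (cos t)\<close> and
    \<open>h (cos u)\<close> share their sign: no zero of the denominator separates \<open>t\<close>
    from \<open>u\<close>.\<close>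
  have "0 < h (cos t) * h (cos t)"
    using False by (auto simp: zero_less_mult_iff linorder_neq_iff)
  then have "0 < a / b * (h (cos t) * h (cos t))"
    using pos by simp
  then have "0 < h (cos t) * h (cos u)"
    by (simp add: h_cos_u mult_ac)
  moreover have "h (sin t) / h (cos t) = h (sin u) / h (cos u)"
    using pos by (simp add: h_cos_u h_sin_u)
  ultimately show ?thesis
    using h_ratio_strict_mono[of t u] h_ratio_strict_mono[of u t] t u
    by (cases t u rule: linorder_cases) (auto simp: mult.commute)
qed

theorem theorem2:
  fixes \<mu>1 \<mu>2 \<mu>3 \<mu>4 \<theta>1 \<theta>2 \<theta>3 \<theta>4 :: real
  assumes "\<mu>1 > 0" and "\<mu>2 > 0" and "\<mu>3 > 0" and "\<mu>4 > 0"
    and "central_configuration \<mu>1 \<mu>2 \<mu>3 \<mu>4 \<theta>1 \<theta>2 \<theta>3 \<theta>4"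
    and "\<theta>1 + \<theta>2 = pi" and "\<theta>3 + \<theta>4 = pi"
  shows "\<theta>1 = \<theta>4 \<and> \<theta>2 = \<theta>3 \<and> \<mu>2 = \<mu>4"
proof -
  have range: "0 < \<theta>1" "\<theta>1 < pi" "0 < \<theta>4" "\<theta>4 < pi"
    and eq1: "\<mu>2 * f \<theta>1 + \<mu>3 * f (\<theta>1 + \<theta>2) + \<mu>4 * f (\<theta>1 + \<theta>2 + \<theta>3) = 0"
    and eq3: "\<mu>4 * f \<theta>3 + \<mu>1 * f (\<theta>3 + \<theta>4) + \<mu>2 * f (\<theta>3 + \<theta>4 + \<theta>1) = 0"
    using assms(5-7) by (auto simp: central_configuration_def)
  have angles: "\<theta>2 = pi - \<theta>1" "\<theta>3 = pi - \<theta>4"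
    using assms(6,7) by auto
  have f_pi: "f pi = 0"
    by (simp add: f_def)
  have "f (\<theta>1 + \<theta>2 + \<theta>3) = - f \<theta>4" "f (\<theta>3 + \<theta>4 + \<theta>1) = - f (pi - \<theta>1)"
    using f_two_pi_minus[of \<theta>4] f_two_pi_minus[of "pi - \<theta>1"] by (simp_all add: angles algebra_simps)
  then have "\<mu>2 * f \<theta>1 = \<mu>4 * f \<theta>4" "\<mu>2 * f (pi - \<theta>1) = \<mu>4 * f (pi - \<theta>4)"
    using eq1 eq3 assms(6,7) f_pi angles by auto
  \<comment> \<open>The positive factors \<open>\<mu>2 * sin \<theta>1\<close> and
    \<open>\<mu>4 * sin \<theta>4\<close> serve as \<open>a\<close> and \<open>b\<close> in
    \<open>proportional_imp_eq\<close>.\<close>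
  then have sin_eq: "\<mu>2 * sin \<theta>1 * h (sin (\<theta>1 / 2)) = \<mu>4 * sin \<theta>4 * h (sin (\<theta>4 / 2))"
    and cos_eq: "\<mu>2 * sin \<theta>1 * h (cos (\<theta>1 / 2)) = \<mu>4 * sin \<theta>4 * h (cos (\<theta>4 / 2))"
    using range by (simp add: f_eq_h, simp add: f_pi_minus)
  have sin_pos: "0 < sin \<theta>1" "0 < sin \<theta>4"
    using range by (auto intro: sin_gt_zero)
  have "\<theta>1 / 2 = \<theta>4 / 2"
    using range sin_pos assms(2,4) by (intro proportional_imp_eq[OF _ _ _ _ _ _ sin_eq cos_eq]) auto
  then have eq: "\<theta>1 = \<theta>4"
    by simp
  have pos: "0 < sin (\<theta>4 / 2)" "0 < cos (\<theta>4 / 2)"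
    using range by (auto intro: sin_gt_zero cos_gt_zero)
  \<comment> \<open>The nonzero value can be cancelled from \<open>sin_eq\<close> or
    \<open>cos_eq\<close>, leaving equality of the masses.\<close>
  have "h (sin (\<theta>4 / 2)) \<noteq> 0 \<or> h (cos (\<theta>4 / 2)) \<noteq> 0"
  proof (rule ccontr)
    assume "\<not> ?thesis"
    then have "sin (\<theta>4 / 2) = 1 / 2" "cos (\<theta>4 / 2) = 1 / 2"
      using pos by (auto simp: h_eq_0_iff)
    then have "(1 / 2)\<^sup>2 + (1 / 2)\<^sup>2 = (1::real)"
      using sin_cos_squared_add[of "\<theta>4 / 2"] by (simp only:)
    then show False
      by (simp add: power2_eq_square)
  qed
  then have "\<mu>2 = \<mu>4"
    using sin_eq cos_eq sin_pos by (auto simp: eq)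
  then show ?thesis
    using eq angles by simp
qed

end
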